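(* Let $\mathbb{F}$ be an infinite field of characteristic different from $2$, and let $G$ be a graph with a cut vertex $v$. Then $mr^{-}(\mathbb{F},G)=4$ if and only if one of the following holds: (i) $G=G_1\cup G_2$ with $V_{G_1}\cap V_{G_2}=\{v\}$, where $G_1$ and $G_2$ are complete multipartite graphs such that $G_1-v$ and $G_2-v$ are nonempty (i.e. each has at least one edge); or (ii) $G-v$ consists of one nonempty complete multipartite component together with isolated vertices.
   Context: All graphs are finite and simple. For a field $\mathbb{F}$ and a graph $G$ on vertices $v_1,\dots,v_n$, $S^{-}(\mathbb{F},G)$ is the set of skew-symmetric matrices $A\in\mathbb{F}^{n\times n}$ ($A^T=-A$) such that for $i\neq j$, $a_{ij}\neq 0$ if and only if $v_iv_j$ is an edge of $G$. The minimum skew rank is $mr^{-}(\mathbb{F},G)=\min\{\operatorname{rank}A : A\in S^{-}(\mathbb{F},G)\}$. A cut vertex is a vertex whose deletion increases the number of connected components. A complete multipartite graph is $K_{n_1,\dots,n_t}$ with $t\ge 2$ and all $n_i\ge 1$. A graph is nonempty if it has at least one edge. $G-v$ denotes $G$ with $v$ and its incident edges deleted; $G_1\cup G_2$ has vertex set $V_{G_1}\cup V_{G_2}$ and edge set $E_{G_1}\cup E_{G_2}$.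
   Formalization: The formal theorem additionally assumes that G has no isolated vertices (automatic if G is connected); without this the claim fails, e.g. for two triangles sharing v plus an isolated vertex, where the minimum skew rank is 4 but neither (i) nor (ii) holds. *)

theory Defs
  imports
    "HOL-Library.Disjoint_Sets"
    "Graph_Theory.Graph_Theory"
    "Jordan_Normal_Form.DL_Rank"
begin

text \<open>
  A finite simple graph is a digraph satisfying the locale \<open>graph\<close> of the entry
  Graph_Theory: finite, loop-free, without parallel arcs and symmetric, an edge being a pair
  of opposite arcs.  Adjacency is \<open>u \<rightarrow>\<^bsub>G\<^esub> w\<close>; by symmetry, the strongly connected components
  \<open>pre_digraph.sccs G\<close> are exactly the connected components of the graph.
\<close>

definition cut_vertex :: "('v, 'e) pre_digraph \<Rightarrow> 'v \<Rightarrow> bool" where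
  "cut_vertex G v \<longleftrightarrow> v \<in> verts G \<and>
     card (pre_digraph.sccs G) < card (pre_digraph.sccs (pre_digraph.del_vert G v))"

definition nonempty_graph :: "('v, 'e) pre_digraph \<Rightarrow> bool" where
  "nonempty_graph G \<longleftrightarrow> arcs G \<noteq> {}"

text \<open>
  Isolated vertices do not change the minimum skew rank, whereas a union of two complete
  multipartite graphs never has any; a characterization by such unions therefore has to be
  restricted to graphs without isolated vertices (e.g. connected graphs with a cut vertex).
\<close>

definition isolated_vertex :: "('v, 'e) pre_digraph \<Rightarrow> 'v \<Rightarrow> bool" where
  "isolated_vertex G u \<longleftrightarrow> u \<in> verts G \<and> (\<forall>w. \<not> u \<rightarrow>\<^bsub>G\<^esub> w)"

text \<open>The parts are the blocks of \<open>P\<close>; \<open>partition_on\<close> makes all of them nonempty.\<close>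

definition complete_multipartite :: "('v, 'e) pre_digraph \<Rightarrow> bool" where
  "complete_multipartite G \<longleftrightarrow> graph G \<and>
     (\<exists>P. partition_on (verts G) P \<and> card P \<ge> 2 \<and>
        (\<forall>u \<in> verts G. \<forall>w \<in> verts G. u \<rightarrow>\<^bsub>G\<^esub> w \<longleftrightarrow> \<not> (\<exists>X \<in> P. u \<in> X \<and> w \<in> X)))"

text \<open>
  The list \<open>vs\<close> is the enumeration \<open>v\<^sub>1, \<dots>, v\<^sub>n\<close> of the vertices of \<open>G\<close> that indexes rows and
  columns.
\<close>

definition skew_matrices :: "'v list \<Rightarrow> ('v, 'e) pre_digraph \<Rightarrow> 'a::field mat set" where
  "skew_matrices vs G =
     {A \<in> carrier_mat (length vs) (length vs). A\<^sup>T = - A \<and>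
        (\<forall>i < length vs. \<forall>j < length vs. i \<noteq> j \<longrightarrow> (A $$ (i, j) \<noteq> 0 \<longleftrightarrow> vs ! i \<rightarrow>\<^bsub>G\<^esub> vs ! j))}"

definition min_skew_rank :: "'a::field itself \<Rightarrow> 'v list \<Rightarrow> ('v, 'e) pre_digraph \<Rightarrow> nat" where
  "min_skew_rank _ vs G =
     (LEAST r. \<exists>A \<in> (skew_matrices vs G :: 'a mat set). r = vec_space.rank (length vs) A)"

end

theory Submission
  imports Defs
begin

text \<open>
  Lower bounds on the rank only use the zero pattern: arcs \<open>(x\<^sub>1, y\<^sub>1), \<dots>, (x\<^sub>k, y\<^sub>k)\<close> such that
  \<open>x\<^sub>i\<close> is not adjacent to \<open>y\<^sub>j\<close> for \<open>i < j\<close> select a triangular submatrix with nonzero diagonal,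
  so every matrix in question has rank at least \<open>k\<close>.  Characteristic \<open>\<noteq> 2\<close> enters because the
  diagonal of the matrix must vanish.  Upper bounds come from sums of matrices
  \<open>f\<^sub>i g\<^sub>j - g\<^sub>i f\<^sub>j\<close> of rank at most 2; over an infinite field a complete multipartite graph is
  realised by \<open>f = 1\<close> and a \<open>g\<close> that separates the parts.

  A graph without isolated vertices that is not complete multipartite contains an arc \<open>u w\<close> and a
  vertex \<open>x\<close> nonadjacent to both, and \<open>x\<close> has some neighbour \<open>z\<close>.  Together with an edge in another
  component of \<open>G - v\<close>, or with a pendant vertex at \<open>v\<close>, this gives a pattern of length 5.  Hence
  rank 4 forces the components of \<open>G - v\<close> (with \<open>v\<close> added, if there are two that carry edges) to be
  complete multipartite.
\<close>

subsection \<open>Rank bounds\<close>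

text \<open>The rows \<open>r i\<close> and columns \<open>c j\<close> cut out a lower triangular
  \<open>M\<close> whose determinant, the product of its diagonal, is nonzero. A dependence among
  the selected columns of \<open>A\<close>, read in the rows \<open>r i\<close>, would be a kernel
  vector of \<open>M\<close>; equal columns are excluded in the same way.\<close>

lemma rank_ge_triangular:
  fixes A :: "'a::field mat"
  assumes A: "A \<in> carrier_mat n m"
    and r: "\<And>i. i < k \<Longrightarrow> r i < n" and c: "\<And>i. i < k \<Longrightarrow> c i < m"
    and diag: "\<And>i. i < k \<Longrightarrow> A $$ (r i, c i) \<noteq> 0"
    and upper: "\<And>i j. i < j \<Longrightarrow> j < k \<Longrightarrow> A $$ (r i, c j) = 0"
  shows "k \<le> vec_space.rank n A"
proof -
  interpret vec_space "TYPE('a)" n .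
  define B where "B = mat n k (\<lambda>(i, j). A $$ (i, c j))"
  define M where "M = mat k k (\<lambda>(i, j). A $$ (r i, c j))"
  have B: "B \<in> carrier_mat n k" and M: "M \<in> carrier_mat k k"
    by (auto simp: B_def M_def)
  have "det M = prod_list (diag_mat M)"
    by (rule det_lower_triangular[OF _ M]) (auto simp: M_def upper)
  also have "\<dots> \<noteq> 0"
    using diag by (auto simp: prod_list_zero_iff diag_mat_def M_def)
  finally have det: "det M \<noteq> 0" .
  have dist: "distinct (cols B)"
  proof (rule ccontr)
    assume "\<not> distinct (cols B)"
    then obtain i j where ij: "i \<noteq> j" "i < k" "j < k" "cols B ! i = cols B ! j"
      using B by (auto simp: distinct_conv_nth)
    then have eq: "col B i = col B j" using B by simp
    have "col M i = col M j"
    proof (rule eq_vecI)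
      fix l assume "l < dim_vec (col M j)"
      then have l: "l < k" by (simp add: M_def)
      have "col B i $ r l = col B j $ r l" by (simp add: eq)
      then show "col M i $ l = col M j $ l"
        using l ij r[OF l] by (simp add: B_def M_def)
    qed (simp add: M_def)
    with det_identical_cols[OF M ij(1-3)] det show False by simp
  qed
  have indpt: "lin_indpt (set (cols B))"
  proof
    assume "lin_dep (set (cols B))"
    then obtain w where w: "w \<in> carrier_vec k" "w \<noteq> 0\<^sub>v k" "B *\<^sub>v w = 0\<^sub>v n"
      using lin_depE[OF B _ dist] by blast
    have "M *\<^sub>v w = 0\<^sub>v k"
    proof (rule eq_vecI)
      fix l assume "l < dim_vec (0\<^sub>v k :: 'a vec)"
      then have l: "l < k" by simp
      have "row M l = row B (r l)"
        using l r[OF l] by (intro eq_vecI) (auto simp: B_def M_def)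
      moreover have "(B *\<^sub>v w) $ r l = 0" using w(3) r[OF l] by simp
      ultimately show "(M *\<^sub>v w) $ l = 0\<^sub>v k $ l"
        using l r[OF l] B M by simp
    qed (use M in simp)
    with w det det_0_iff_vec_prod_zero_field[OF M] show False by blast
  qed
  have "set (cols B) \<subseteq> set (cols A)"
  proof
    fix x assume "x \<in> set (cols B)"
    then obtain j where j: "j < k" "x = col B j"
      using B by (auto simp: cols_def)
    have "col B j = col A (c j)"
      using j c[of j] A by (intro eq_vecI) (auto simp: B_def)
    then show "x \<in> set (cols A)"
      using j c[of j] A by (auto simp: cols_def)
  qed
  from rank_ge_card_indpt[OF A this indpt] show ?thesis
    using distinct_card[OF dist] B by simp
qed

text \<open>A sum of two outer products, of \<open>f\<close> with \<open>g\<close> and of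
  \<open>-g\<close> with \<open>f\<close>, each of rank at most 1.\<close>

lemma rank_wedge_le_2:
  "vec_space.rank n (mat n n (\<lambda>(i, j). f i * g j - g i * f j :: 'a::field)) \<le> 2"
proof -
  interpret vec_space "TYPE('a)" n .
  let ?P = "\<lambda>f g :: nat \<Rightarrow> 'a. mat n n (\<lambda>(i, j). f i * g j)"
  have "mat n n (\<lambda>(i, j). f i * g j - g i * f j) = ?P f g + ?P (\<lambda>i. - g i) f"
    by (intro eq_matI) auto
  moreover have "rank (?P f g) \<le> 1" for f g
    by (rule rank_le_1_product_entries[where f = f and g = g]) auto
  note this[of f g] this[of "\<lambda>i. - g i" f]
  moreover have "rank (?P f g + ?P (\<lambda>i. - g i) f) \<le> rank (?P f g) + rank (?P (\<lambda>i. - g i) f)"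
    by (rule rank_subadditive) auto
  ultimately show ?thesis by simp
qed

section \<open>Zero patterns and bounds for the minimum skew rank\<close>

lemma two_neq_zero_if_CHAR_neq_2:
  assumes "CHAR('a::field) \<noteq> 2"
  shows "(2 :: 'a) \<noteq> 0"
proof
  assume "(2 :: 'a) = 0"
  then have "of_nat 2 = (0 :: 'a)" by simp
  then have "CHAR('a) dvd 2" by (simp only: of_nat_eq_0_iff_char_dvd)
  then have "CHAR('a) = 1 \<or> CHAR('a) = 2"
    using two_is_prime_nat by (auto simp: prime_nat_iff)
  with assms CHAR_not_1 show False by auto
qed

text \<open>Each pair in \<open>ps\<close> names the row and the column of a diagonal entry of the
  triangular submatrix. A vertex may be a row in one pair and a column in another, so diagonal
  entries of \<open>A\<close> occur too; in characteristic other than 2 they vanish, in accordance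
  with the absence of loops.\<close>

lemma skew_matrices_rank_ge:
  fixes A :: "'a::field mat"
  assumes A: "A \<in> skew_matrices vs G" and char: "CHAR('a) \<noteq> 2"
    and G: "graph G" and vs: "set vs = verts G"
    and upper: "sorted_wrt (\<lambda>p q. \<not> fst p \<rightarrow>\<^bsub>G\<^esub> snd q) ps"
    and diag: "\<forall>p \<in> set ps. fst p \<rightarrow>\<^bsub>G\<^esub> snd p"
  shows "length ps \<le> vec_space.rank (length vs) A"
proof -
  interpret graph G by (rule G)
  have carrier: "A \<in> carrier_mat (length vs) (length vs)" and skew: "A\<^sup>T = - A"
    and pat: "\<And>i j. i < length vs \<Longrightarrow> j < length vs \<Longrightarrow> i \<noteq> j \<Longrightarrow> A $$ (i, j) \<noteq> 0 \<longleftrightarrow> vs ! i \<rightarrow>\<^bsub>G\<^esub> vs ! j"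
    using A by (auto simp: skew_matrices_def)
  \<comment> \<open>On the diagonal, skew symmetry reads \<open>a = - a\<close>, hence
    \<open>2 * a = 0\<close>.\<close>
  have zero: "A $$ (i, i) = 0" if "i < length vs" for i
  proof -
    have "A\<^sup>T $$ (i, i) = (- A) $$ (i, i)" by (simp add: skew)
    then have "2 * A $$ (i, i) = 0" using carrier that by (simp add: eq_neg_iff_add_eq_0)
    then show ?thesis using two_neq_zero_if_CHAR_neq_2[OF char] by simp
  qed
  have adj: "A $$ (i, j) \<noteq> 0 \<longleftrightarrow> vs ! i \<rightarrow>\<^bsub>G\<^esub> vs ! j" if "i < length vs" "j < length vs" for i j
    using pat[OF that] zero[OF that(1)] adj_not_same by (cases "i = j") auto
  have "\<forall>x \<in> verts G. \<exists>i < length vs. vs ! i = x"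
    using vs by (metis in_set_conv_nth)
  then obtain ix where ix: "\<And>x. x \<in> verts G \<Longrightarrow> ix x < length vs \<and> vs ! ix x = x"
    by metis
  have ps: "fst (ps ! i) \<in> verts G" "snd (ps ! i) \<in> verts G" if "i < length ps" for i
    using diag that adj_in_verts by (metis nth_mem)+
  show ?thesis
  proof (rule rank_ge_triangular[OF carrier,
        where r = "\<lambda>i. ix (fst (ps ! i))" and c = "\<lambda>i. ix (snd (ps ! i))"])
    fix i assume "i < length ps"
    then show "A $$ (ix (fst (ps ! i)), ix (snd (ps ! i))) \<noteq> 0"
      using ix ps diag adj by auto
  next
    fix i j assume ij: "i < j" "j < length ps"
    then have "\<not> fst (ps ! i) \<rightarrow>\<^bsub>G\<^esub> snd (ps ! j)"
      using sorted_wrt_nth_less[OF upper] by simp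
    then show "A $$ (ix (fst (ps ! i)), ix (snd (ps ! j))) = 0"
      using ix[OF ps(1)[of i]] ix[OF ps(2)[of j]] ij
        adj[of "ix (fst (ps ! i))" "ix (snd (ps ! j))"] by simp
  qed (use ix ps in auto)
qed

lemma min_skew_rank_le:
  assumes "(A :: 'a::field mat) \<in> skew_matrices vs G" "vec_space.rank (length vs) A \<le> r"
  shows "min_skew_rank TYPE('a) vs G \<le> r"
  unfolding min_skew_rank_def by (rule order_trans[OF Least_le assms(2)]) (use assms(1) in blast)

text \<open>\<open>LEAST\<close> is meaningful only if some matrix realises the graph; over every
  field the sign matrix with 1 above and -1 below the diagonal does.\<close>

lemma min_skew_rank_attained:
  fixes G :: "('v, 'e) pre_digraph"
  assumes G: "graph G"
  obtains A :: "'a::field mat" where "A \<in> skew_matrices vs G"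
    "vec_space.rank (length vs) A = min_skew_rank TYPE('a) vs G"
proof -
  interpret graph G by (rule G)
  define A where "A = mat (length vs) (length vs) (\<lambda>(i, j). if vs ! i \<rightarrow>\<^bsub>G\<^esub> vs ! j
    then if i < j then 1 else if j < i then -1 else (0 :: 'a) else 0)"
  have "A \<in> skew_matrices vs G"
    unfolding skew_matrices_def A_def
    by (auto intro!: eq_matI simp: graph_symmetric)
  then have "\<exists>A \<in> (skew_matrices vs G :: 'a mat set).
      vec_space.rank (length vs) A = vec_space.rank (length vs) A" by blast
  then have "\<exists>r. \<exists>A \<in> (skew_matrices vs G :: 'a mat set). r = vec_space.rank (length vs) A"
    by blast
  from LeastI_ex[OF this] show ?thesis
    using that unfolding min_skew_rank_def by metis
qed

text \<open>A wedge is skew-symmetric for all \<open>f\<close> and \<open>g\<close>, so only its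
  off-diagonal zero pattern has to be matched with the graph.\<close>

lemma min_skew_rank_wedge_le:
  fixes G :: "('v, 'e) pre_digraph" and f g :: "'v \<Rightarrow> 'a::field"
  assumes vs: "distinct vs" "set vs = verts G"
    and adj: "\<And>x y. x \<in> verts G \<Longrightarrow> y \<in> verts G \<Longrightarrow> x \<noteq> y \<Longrightarrow> f x * g y - g x * f y \<noteq> 0 \<longleftrightarrow> x \<rightarrow>\<^bsub>G\<^esub> y"
  shows "min_skew_rank TYPE('a) vs G \<le> 2"
proof (rule min_skew_rank_le)
  let ?A = "mat (length vs) (length vs)
    (\<lambda>(i, j). f (vs ! i) * g (vs ! j) - g (vs ! i) * f (vs ! j))"
  show "vec_space.rank (length vs) ?A \<le> 2" by (rule rank_wedge_le_2)
  have "?A $$ (i, j) \<noteq> 0 \<longleftrightarrow> vs ! i \<rightarrow>\<^bsub>G\<^esub> vs ! j" if "i < length vs" "j < length vs" "i \<noteq> j" for i j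
    using that adj[of "vs ! i" "vs ! j"] vs(2)[symmetric] nth_eq_iff_index_eq[OF vs(1)] by simp
  then show "?A \<in> skew_matrices vs G"
    unfolding skew_matrices_def by (auto intro!: eq_matI simp: algebra_simps)
qed

text \<open>Rank subadditivity gives 2 + 2. The pattern is that of the sum, so each application has
  to exclude cancellation between the wedges.\<close>

lemma min_skew_rank_two_wedges_le:
  fixes G :: "('v, 'e) pre_digraph" and f g h k :: "'v \<Rightarrow> 'a::field"
  assumes vs: "distinct vs" "set vs = verts G"
    and adj: "\<And>x y. x \<in> verts G \<Longrightarrow> y \<in> verts G \<Longrightarrow> x \<noteq> y \<Longrightarrow>
      (f x * g y - g x * f y) + (h x * k y - k x * h y) \<noteq> 0 \<longleftrightarrow> x \<rightarrow>\<^bsub>G\<^esub> y"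
  shows "min_skew_rank TYPE('a) vs G \<le> 4"
proof (rule min_skew_rank_le)
  interpret vec_space "TYPE('a)" "length vs" .
  let ?W = "\<lambda>f g :: 'v \<Rightarrow> 'a. mat (length vs) (length vs)
    (\<lambda>(i, j). f (vs ! i) * g (vs ! j) - g (vs ! i) * f (vs ! j))"
  have "rank (?W f g + ?W h k) \<le> rank (?W f g) + rank (?W h k)"
    by (rule rank_subadditive) auto
  also have "\<dots> \<le> 2 + 2" by (intro add_mono rank_wedge_le_2)
  finally show "rank (?W f g + ?W h k) \<le> 4" by simp
  have "(?W f g + ?W h k) $$ (i, j) \<noteq> 0 \<longleftrightarrow> vs ! i \<rightarrow>\<^bsub>G\<^esub> vs ! j" if "i < length vs" "j < length vs" "i \<noteq> j" for i j
    using that adj[of "vs ! i" "vs ! j"] vs(2)[symmetric] nth_eq_iff_index_eq[OF vs(1)] by simp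
  then show "?W f g + ?W h k \<in> skew_matrices vs G"
    unfolding skew_matrices_def by (auto intro!: eq_matI simp: algebra_simps)
qed

subsection \<open>Complete multipartite graphs and components\<close>

lemma dominates_induce_subgraph:
  "u \<rightarrow>\<^bsub>G \<restriction> S\<^esub> w \<longleftrightarrow> u \<rightarrow>\<^bsub>G\<^esub> w \<and> u \<in> S \<and> w \<in> S"
  by (auto simp: arcs_ends_conv)

lemma dominates_induced:
  assumes "induced_subgraph C G"
  shows "u \<rightarrow>\<^bsub>C\<^esub> w \<longleftrightarrow> u \<rightarrow>\<^bsub>G\<^esub> w \<and> u \<in> verts C \<and> w \<in> verts C"
proof -
  have "wf_digraph G" using assms by (simp add: induced_subgraph_def subgraph_def)
  then have "G \<restriction> verts C = C" using assms by (rule wf_digraph.induce_eq_iff_induced)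
  then show ?thesis using dominates_induce_subgraph[of u w G "verts C"] by simp
qed

lemma dominates_del_vert:
  "u \<rightarrow>\<^bsub>pre_digraph.del_vert G v\<^esub> w \<longleftrightarrow> u \<rightarrow>\<^bsub>G\<^esub> w \<and> u \<noteq> v \<and> w \<noteq> v"
  by (auto simp: arcs_ends_conv pre_digraph.del_vert_simps)

lemma dominates_union:
  assumes "compatible G H"
  shows "u \<rightarrow>\<^bsub>Digraph_Component.union G H\<^esub> w \<longleftrightarrow> u \<rightarrow>\<^bsub>G\<^esub> w \<or> u \<rightarrow>\<^bsub>H\<^esub> w"
  using assms by (auto simp: arcs_ends_conv compatible_def)

lemma nonempty_graph_iff: "nonempty_graph G \<longleftrightarrow> (\<exists>u w. u \<rightarrow>\<^bsub>G\<^esub> w)"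
  by (auto simp: nonempty_graph_def arcs_ends_conv)

lemma graph_induce_subgraph:
  assumes "graph G" "S \<subseteq> verts G"
  shows "graph (G \<restriction> S)"
proof -
  interpret graph G by fact
  have ind: "induced_subgraph (G \<restriction> S) G" using assms(2) by auto
  interpret H: digraph "G \<restriction> S" using ind by (rule digraphI_induced)
  show ?thesis by (rule H.graphI[OF induced_graph_imp_symmetric[OF sym_arcs ind]])
qed

lemma graph_del_vert:
  assumes "graph G"
  shows "graph (pre_digraph.del_vert G v)"
proof -
  interpret graph G by fact
  have "del_vert v = G \<restriction> (verts G - {v})"
    by (auto simp: del_vert_def induce_subgraph_def)
  then show ?thesis using graph_induce_subgraph[OF assms, of "verts G - {v}"] by auto
qed

section \<open>Complete multipartite graphs via transitivity of nonadjacency\<close>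

text \<open>Nonadjacency is reflexive and symmetric in every graph; once transitive, it is an
  equivalence relation whose classes serve as parts. The arc from \<open>a\<close> to
  \<open>b\<close> separates two classes, so there are at least two parts.\<close>

lemma complete_multipartiteI:
  assumes G: "graph G" and "a \<rightarrow>\<^bsub>G\<^esub> b"
    and trans: "\<And>u x w. \<lbrakk>u \<in> verts G; x \<in> verts G; w \<in> verts G; \<not> u \<rightarrow>\<^bsub>G\<^esub> x; \<not> x \<rightarrow>\<^bsub>G\<^esub> w\<rbrakk> \<Longrightarrow> \<not> u \<rightarrow>\<^bsub>G\<^esub> w"
  shows "complete_multipartite G"
proof -
  interpret graph G by (rule G)
  define R where "R = {(u, w). u \<in> verts G \<and> w \<in> verts G \<and> \<not> u \<rightarrow>\<^bsub>G\<^esub> w}"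
  have equiv: "equiv (verts G) R"
  proof (rule equivI)
    show "R \<subseteq> verts G \<times> verts G" "sym R"
      by (auto simp: R_def sym_def dest: graph_symmetric)
    show "refl_on (verts G) R" by (auto simp: R_def refl_on_def dest: adj_not_same)
    show "trans R" unfolding trans_def R_def using trans by blast
  qed
  define P where "P = verts G // R"
  have part: "partition_on (verts G) P"
    unfolding P_def by (rule partition_on_quotient[OF equiv])
  have adj: "u \<rightarrow>\<^bsub>G\<^esub> w \<longleftrightarrow> \<not> (\<exists>X \<in> P. u \<in> X \<and> w \<in> X)" if "u \<in> verts G" "w \<in> verts G" for u w
  proof -
    have "(\<exists>X \<in> P. u \<in> X \<and> w \<in> X) \<longleftrightarrow> (u, w) \<in> R"
      unfolding P_def using equiv that
      by (metis equiv_class_self in_quotient_imp_in_rel quotientI Image_singleton_iff empty_subsetI insert_subset)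
    then show ?thesis using that by (auto simp: R_def)
  qed
  have ab: "a \<in> verts G" "b \<in> verts G" using adj_in_verts assms(2) by auto
  then obtain X Y where XY: "X \<in> P" "a \<in> X" "Y \<in> P" "b \<in> Y"
    using part by (metis UnionE partition_onD1)
  with adj[OF ab] assms(2) have "X \<noteq> Y" by blast
  moreover have "finite P" using part finite_verts by (metis finite_elements)
  ultimately have "card P \<ge> 2"
    using XY card_mono[of P "{X, Y}"] by simp
  with part adj G show ?thesis unfolding complete_multipartite_def by blast
qed

text \<open>The second case is a failure of transitivity of nonadjacency, with a neighbour
  \<open>z\<close> of the middle vertex \<open>x\<close>. It makes the pairs
  \<open>(x, z), (u, w), (w, u), (z, x)\<close> triangular, the core of the patterns of length
  5.\<close>

lemma complete_multipartite_cases: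
  assumes G: "graph G" and ab: "a \<rightarrow>\<^bsub>G\<^esub> b"
    and no_isolated: "\<And>x. x \<in> verts G \<Longrightarrow> \<exists>z. x \<rightarrow>\<^bsub>G\<^esub> z"
  obtains "complete_multipartite G"
  | u w x z where "u \<rightarrow>\<^bsub>G\<^esub> w" "\<not> x \<rightarrow>\<^bsub>G\<^esub> u" "\<not> x \<rightarrow>\<^bsub>G\<^esub> w" "x \<rightarrow>\<^bsub>G\<^esub> z"
proof (cases "complete_multipartite G")
  case False
  interpret graph G by (rule G)
  from False obtain u x w where "x \<in> verts G" "\<not> u \<rightarrow>\<^bsub>G\<^esub> x" "\<not> x \<rightarrow>\<^bsub>G\<^esub> w" "u \<rightarrow>\<^bsub>G\<^esub> w"
    using complete_multipartiteI[OF G ab] by blast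
  with no_isolated that(2) graph_symmetric show ?thesis by blast
qed (rule that(1))

text \<open>Each part receives its own field element, which an infinite field can supply. The wedge
  of \<open>1\<close> and \<open>t\<close> has entries \<open>t w - t u\<close> and so realises the
  graph.\<close>

lemma complete_multipartite_labelling:
  fixes G :: "('v, 'e) pre_digraph"
  assumes "infinite (UNIV :: 'a set)" "complete_multipartite G"
  obtains t :: "'v \<Rightarrow> 'a"
  where "\<And>u w. u \<in> verts G \<Longrightarrow> w \<in> verts G \<Longrightarrow> t u \<noteq> t w \<longleftrightarrow> u \<rightarrow>\<^bsub>G\<^esub> w"
proof -
  from assms(2) interpret graph G by (simp add: complete_multipartite_def)
  from assms(2) obtain P where part: "partition_on (verts G) P"
    and adj: "\<And>u w. u \<in> verts G \<Longrightarrow> w \<in> verts G \<Longrightarrow> u \<rightarrow>\<^bsub>G\<^esub> w \<longleftrightarrow> \<not> (\<exists>X \<in> P. u \<in> X \<and> w \<in> X)"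
    unfolding complete_multipartite_def by blast
  have "finite P" using part finite_verts by (metis finite_elements)
  then obtain s :: "'v set \<Rightarrow> 'a" where s: "inj_on s P"
    using assms(1) by (metis finite_imp_inj_to_nat_seg infinite_countable_subset comp_inj_on subset_UNIV inj_on_subset)
  have "\<forall>u \<in> verts G. \<exists>X. X \<in> P \<and> u \<in> X" using partition_onD1[OF part] by auto
  then obtain c where c: "\<And>u. u \<in> verts G \<Longrightarrow> c u \<in> P \<and> u \<in> c u"
    unfolding bchoice_iff by blast
  have "c u = c w \<longleftrightarrow> (\<exists>X \<in> P. u \<in> X \<and> w \<in> X)" if "u \<in> verts G" "w \<in> verts G" for u w
    using c[OF that(1)] c[OF that(2)] disjointD[OF partition_onD2[OF part]] by blast
  then have "s (c u) \<noteq> s (c w) \<longleftrightarrow> u \<rightarrow>\<^bsub>G\<^esub> w" if "u \<in> verts G" "w \<in> verts G" for u w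
    using adj[OF that] inj_on_eq_iff[OF s] c[OF that(1)] c[OF that(2)] that by blast
  then show ?thesis by (rule that)
qed

section \<open>Components after deletion of a vertex\<close>

lemma (in graph) sccs_verts_closed:
  assumes "S \<in> sccs_verts" "x \<in> S" "x \<rightarrow> y"
  shows "y \<in> S"
proof -
  have "x \<rightarrow>\<^sup>* y" "y \<rightarrow>\<^sup>* x" using assms(3) graph_symmetric by blast+
  then show ?thesis using assms(1,2) by (auto simp: in_sccs_verts_conv_reachable)
qed

text \<open>The first step of a path from \<open>x\<close> to \<open>a\<close> leads to a neighbour,
  which belongs to the same component.\<close>

lemma (in graph) sccs_verts_ex_neighbour:
  assumes "S \<in> sccs_verts" "a \<in> S" "a \<rightarrow> b" "x \<in> S"
  shows "\<exists>z \<in> S. x \<rightarrow> z"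
proof (cases "x = a")
  case True
  then show ?thesis using assms sccs_verts_closed by blast
next
  case False
  have "x \<rightarrow>\<^sup>* a" using assms by (auto simp: in_sccs_verts_conv_reachable)
  then have "(x, a) \<in> (arcs_ends G)\<^sup>*" by (rule reachable_rtranclI)
  with False obtain z where "x \<rightarrow> z" by (metis converse_rtranclE)
  then show ?thesis using assms sccs_verts_closed by blast
qed

text \<open>\<open>G\<close> has at least one component, that of \<open>v\<close>, so deleting the
  cut vertex leaves at least two; one of them is disjoint from \<open>S\<close>.\<close>

lemma cut_vertex_outside_component:
  assumes G: "graph G" and cut: "cut_vertex G v"
    and S: "S \<in> pre_digraph.sccs_verts (pre_digraph.del_vert G v)"
  obtains u where "u \<in> verts G" "u \<noteq> v" "u \<notin> S"
proof -
  interpret graph G by (rule G)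
  interpret H: graph "del_vert v" using G by (rule graph_del_vert)
  have v: "v \<in> verts G" using cut by (simp add: cut_vertex_def)
  have "1 \<le> card sccs_verts"
    using finite_sccs_verts scc_of_in_sccs_verts[OF v] by (metis One_nat_def Suc_leI card_gt_0_iff empty_iff)
  then have two: "2 \<le> card H.sccs_verts"
    using cut by (simp add: cut_vertex_def card_sccs_verts H.card_sccs_verts)
  then have "H.sccs_verts \<noteq> {S}" by auto
  then obtain T where T: "T \<in> H.sccs_verts" "T \<noteq> S" using S by blast
  then have "T \<inter> S = {}" "T \<noteq> {}" using S H.sccs_verts_disjoint H.in_sccs_verts_conv_reachable by blast+
  then obtain u where "u \<in> T" "u \<notin> S" by blast
  with H.sccs_verts_subsets[OF T(1)] that show ?thesis by (auto simp: pre_digraph.del_vert_simps)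
qed

text \<open>At most two components after the deletion means at most one before, so \<open>S\<close>
  and \<open>v\<close> are connected in \<open>G\<close>; a path from \<open>S\<close> can leave
  \<open>S\<close> only by an arc into \<open>v\<close>.\<close>

lemma cut_vertex_adjacent_component:
  assumes G: "graph G" and cut: "cut_vertex G v"
    and sccs: "pre_digraph.sccs_verts (pre_digraph.del_vert G v) = {S, T}"
  obtains s where "s \<in> S" "v \<rightarrow>\<^bsub>G\<^esub> s"
proof -
  interpret graph G by (rule G)
  interpret H: graph "del_vert v" using G by (rule graph_del_vert)
  have v: "v \<in> verts G" using cut by (simp add: cut_vertex_def)
  have S: "S \<in> H.sccs_verts" using sccs by simp
  have S_H: "S \<subseteq> verts G - {v}" using H.sccs_verts_subsets[OF S] by (simp add: pre_digraph.del_vert_simps)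
  obtain s where s: "s \<in> S" using S by (auto simp: H.in_sccs_verts_conv_reachable)
  have "card sccs_verts < card H.sccs_verts"
    using cut by (simp add: cut_vertex_def card_sccs_verts H.card_sccs_verts)
  also have "\<dots> \<le> 2" by (simp add: sccs card_insert_if)
  finally have "card sccs_verts \<le> 1" by simp
  then have "scc_of s = scc_of v"
    using finite_sccs_verts scc_of_in_sccs_verts v s S_H by (metis Diff_iff One_nat_def card_le_Suc0_iff_eq subset_iff)
  then have "s \<rightarrow>\<^sup>*\<^bsub>G\<^esub> v" using in_scc_of_self[OF v] by (auto simp: scc_of_def)
  then have "(s, v) \<in> (arcs_ends G)\<^sup>*" by (rule reachable_rtranclI)
  \<comment> \<open>Induction along the path: it stays in \<open>S\<close> until an arc into
    \<open>v\<close> is met.\<close>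
  moreover have "x \<in> S \<or> (\<exists>s \<in> S. s \<rightarrow>\<^bsub>G\<^esub> v)" if "(s, x) \<in> (arcs_ends G)\<^sup>*" for x
    using that
  proof induction
    case (step x y)
    then show ?case
      using H.sccs_verts_closed[OF S, of x y] S_H by (auto simp: dominates_del_vert)
  qed (use s in auto)
  ultimately show ?thesis using S_H that graph_symmetric by blast
qed

lemma del_vert_isolatedD:
  assumes "\<not> (\<exists>u. isolated_vertex G u)"
    and "isolated_vertex (pre_digraph.del_vert G v) r"
  shows "r \<rightarrow>\<^bsub>G\<^esub> w \<longleftrightarrow> w = v"
proof -
  have r: "r \<in> verts G" "r \<noteq> v"
    using assms(2) by (auto simp: isolated_vertex_def pre_digraph.del_vert_simps)
  have "w = v" if "r \<rightarrow>\<^bsub>G\<^esub> w" for w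
    using assms(2) that r by (auto simp: isolated_vertex_def dominates_del_vert)
  moreover obtain w where "r \<rightarrow>\<^bsub>G\<^esub> w"
    using assms(1) r by (auto simp: isolated_vertex_def)
  ultimately show ?thesis by blast
qed

section \<open>Forbidden patterns of length five\<close>

text \<open>A violation in \<open>insert v S\<close> provides three triangular pairs whose rows lie
  in \<open>S\<close>. Edges leaving \<open>S\<close> end in \<open>v\<close>, so these rows vanish
  at \<open>p\<close> and \<open>q\<close>, and appending \<open>(p, q), (q, p)\<close> gives length
  5.\<close>

lemma block_multipartite:
  assumes G: "graph G" and S: "S \<in> pre_digraph.sccs_verts (pre_digraph.del_vert G v)"
    and bound: "\<And>ps. sorted_wrt (\<lambda>p q. \<not> fst p \<rightarrow>\<^bsub>G\<^esub> snd q) ps \<Longrightarrow>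
      \<forall>p \<in> set ps. fst p \<rightarrow>\<^bsub>G\<^esub> snd p \<Longrightarrow> length ps \<le> 4"
    and ab: "a \<in> S" "a \<rightarrow>\<^bsub>G\<^esub> b" "b \<noteq> v"
    and v: "v \<in> verts G" "s \<in> S" "v \<rightarrow>\<^bsub>G\<^esub> s"
    and pq: "p \<rightarrow>\<^bsub>G\<^esub> q" "p \<noteq> v" "q \<noteq> v" "p \<notin> S" "q \<notin> S"
  shows "complete_multipartite (G \<restriction> insert v S)"
proof -
  interpret graph G by (rule G)
  interpret H: graph "del_vert v" using G by (rule graph_del_vert)
  let ?K = "G \<restriction> insert v S"
  have S_sub: "S \<subseteq> verts G" and v_S: "v \<notin> S"
    using H.sccs_verts_subsets[OF S] by (auto simp: pre_digraph.del_vert_simps)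
  have K: "graph ?K" using S_sub v(1) by (intro graph_induce_subgraph[OF G]) auto
  have closed: "y \<in> S" if "x \<in> S" "x \<rightarrow>\<^bsub>G\<^esub> y" "y \<noteq> v" for x y
    using H.sccs_verts_closed[OF S that(1), of y] that v_S by (auto simp: dominates_del_vert)
  have S_pq: "\<not> x \<rightarrow>\<^bsub>G\<^esub> p" "\<not> x \<rightarrow>\<^bsub>G\<^esub> q" if "x \<in> S" for x
    using closed[OF that] pq by blast+
  have irrefl: "\<not> x \<rightarrow>\<^bsub>G\<^esub> x" for x using adj_not_same by blast
  have sym: "y \<rightarrow>\<^bsub>G\<^esub> x" if "x \<rightarrow>\<^bsub>G\<^esub> y" for x y using that by (rule graph_symmetric)
  have "a \<rightarrow>\<^bsub>?K\<^esub> b" using ab closed by (auto simp: dominates_induce_subgraph)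
  moreover have "\<exists>z. x \<rightarrow>\<^bsub>?K\<^esub> z" if "x \<in> verts ?K" for x
  proof (cases "x = v")
    case True
    then show ?thesis using v by (auto simp: dominates_induce_subgraph)
  next
    case False
    with that have "x \<in> S" by simp
    then show ?thesis
      using H.sccs_verts_ex_neighbour[OF S ab(1), of b x] ab v_S
      by (auto simp: dominates_induce_subgraph dominates_del_vert)
  qed
  ultimately show ?thesis
  proof (rule complete_multipartite_cases[OF K])
    fix u w x z
    assume "u \<rightarrow>\<^bsub>?K\<^esub> w" "\<not> x \<rightarrow>\<^bsub>?K\<^esub> u" "\<not> x \<rightarrow>\<^bsub>?K\<^esub> w" "x \<rightarrow>\<^bsub>?K\<^esub> z"
    then have mem: "u \<in> insert v S" "w \<in> insert v S" "x \<in> insert v S" "z \<in> insert v S"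
      and adj: "u \<rightarrow>\<^bsub>G\<^esub> w" "\<not> x \<rightarrow>\<^bsub>G\<^esub> u" "\<not> x \<rightarrow>\<^bsub>G\<^esub> w" "x \<rightarrow>\<^bsub>G\<^esub> z"
      by (auto simp: dominates_induce_subgraph)
    then have adj': "w \<rightarrow>\<^bsub>G\<^esub> u" "\<not> u \<rightarrow>\<^bsub>G\<^esub> x" "\<not> w \<rightarrow>\<^bsub>G\<^esub> x" "z \<rightarrow>\<^bsub>G\<^esub> x" "q \<rightarrow>\<^bsub>G\<^esub> p"
      using sym pq by blast+
    \<comment> \<open>\<open>v\<close> may be adjacent to \<open>p\<close> and \<open>q\<close>, so \<open>v\<close> must not be used as a row.\<close>
    have mid: False if e: "u \<rightarrow>\<^bsub>G\<^esub> w" "w \<rightarrow>\<^bsub>G\<^esub> u" "\<not> w \<rightarrow>\<^bsub>G\<^esub> x" "\<not> x \<rightarrow>\<^bsub>G\<^esub> u"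
      and m: "v = u" "w \<in> insert v S" for u w
    proof -
      have "u \<noteq> w" "z \<noteq> u" "x \<noteq> u" using e adj adj' irrefl by blast+
      then have "w \<in> S" "x \<in> S" "z \<in> S" using m mem by auto
      then show False
        using bound[of "[(x, z), (w, u), (z, x), (p, q), (q, p)]"] e adj adj' pq irrefl S_pq by simp
    qed
    \<comment> \<open>The pairs \<open>(x, z), (u, w), (w, u), (z, x)\<close> are triangular in this
      order. The one with row \<open>v\<close> is dropped; if \<open>v\<close> is none of
      \<open>x\<close>, \<open>u\<close>, \<open>w\<close>, then \<open>(z, x)\<close> is dropped
      because \<open>z\<close> may be \<open>v\<close>.\<close>
    consider "v = x" | "v = u" | "v = w" | "v \<notin> {x, u, w}" by blast
    then have False
    proof cases
      assume "v = x"
      moreover from this adj adj' irrefl have "u \<noteq> v" "w \<noteq> v" "z \<noteq> v" by blast+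
      ultimately have "u \<in> S" "w \<in> S" "z \<in> S" using mem by auto
      then show False
        using bound[of "[(u, w), (w, u), (z, x), (p, q), (q, p)]"] adj adj' pq irrefl S_pq by simp
    next
      assume "v \<notin> {x, u, w}"
      then have "x \<in> S" "u \<in> S" "w \<in> S" using mem by auto
      then show False
        using bound[of "[(x, z), (u, w), (w, u), (p, q), (q, p)]"] adj adj' pq irrefl S_pq by simp
    qed (use mid[of u w] mid[of w u] adj adj' mem in auto)
    then show ?thesis ..
  qed
qed

text \<open>The row of \<open>r\<close> vanishes except at \<open>v\<close>, so
  \<open>(r, v)\<close> can precede all four pairs \<open>(x, z), (u, w), (w, u), (z, x)\<close> of
  a violation inside \<open>S\<close>. As \<open>v\<close> occurs only as the first column, its
  neighbours in \<open>S\<close> may be arbitrary.\<close>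

lemma pendant_component_multipartite:
  assumes G: "graph G" and S: "S \<in> pre_digraph.sccs_verts (pre_digraph.del_vert G v)"
    and bound: "\<And>ps. sorted_wrt (\<lambda>p q. \<not> fst p \<rightarrow>\<^bsub>G\<^esub> snd q) ps \<Longrightarrow>
      \<forall>p \<in> set ps. fst p \<rightarrow>\<^bsub>G\<^esub> snd p \<Longrightarrow> length ps \<le> 4"
    and ab: "a \<in> S" "a \<rightarrow>\<^bsub>G\<^esub> b" "b \<noteq> v"
    and r: "\<And>w. r \<rightarrow>\<^bsub>G\<^esub> w \<longleftrightarrow> w = v"
  shows "complete_multipartite (G \<restriction> S)"
proof -
  interpret graph G by (rule G)
  interpret H: graph "del_vert v" using G by (rule graph_del_vert)
  have S_sub: "S \<subseteq> verts G" and v_S: "v \<notin> S"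
    using H.sccs_verts_subsets[OF S] by (auto simp: pre_digraph.del_vert_simps)
  have K: "graph (G \<restriction> S)" using S_sub by (rule graph_induce_subgraph[OF G])
  have "b \<in> S"
    using H.sccs_verts_closed[OF S ab(1), of b] ab v_S by (auto simp: dominates_del_vert)
  then have "a \<rightarrow>\<^bsub>G \<restriction> S\<^esub> b" using ab by (simp add: dominates_induce_subgraph)
  moreover have "\<exists>z. x \<rightarrow>\<^bsub>G \<restriction> S\<^esub> z" if "x \<in> verts (G \<restriction> S)" for x
    using H.sccs_verts_ex_neighbour[OF S ab(1), of b x] ab v_S that
    by (auto simp: dominates_induce_subgraph dominates_del_vert)
  ultimately show ?thesis
  proof (rule complete_multipartite_cases[OF K])
    fix u w x z
    assume "u \<rightarrow>\<^bsub>G \<restriction> S\<^esub> w" "\<not> x \<rightarrow>\<^bsub>G \<restriction> S\<^esub> u" "\<not> x \<rightarrow>\<^bsub>G \<restriction> S\<^esub> w" "x \<rightarrow>\<^bsub>G \<restriction> S\<^esub> z"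
    then have mem: "u \<in> S" "w \<in> S" "x \<in> S" "z \<in> S"
      and adj: "u \<rightarrow>\<^bsub>G\<^esub> w" "\<not> x \<rightarrow>\<^bsub>G\<^esub> u" "\<not> x \<rightarrow>\<^bsub>G\<^esub> w" "x \<rightarrow>\<^bsub>G\<^esub> z"
      by (auto simp: dominates_induce_subgraph)
    then have adj': "w \<rightarrow>\<^bsub>G\<^esub> u" "\<not> u \<rightarrow>\<^bsub>G\<^esub> x" "\<not> w \<rightarrow>\<^bsub>G\<^esub> x" "z \<rightarrow>\<^bsub>G\<^esub> x"
      using graph_symmetric by blast+
    have "u \<noteq> v" "w \<noteq> v" "x \<noteq> v" "z \<noteq> v" using mem v_S by auto
    moreover have "\<not> x \<rightarrow>\<^bsub>G\<^esub> x" "\<not> u \<rightarrow>\<^bsub>G\<^esub> u" for x u using adj_not_same by blast+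
    ultimately show ?thesis
      using bound[of "[(r, v), (x, z), (u, w), (w, u), (z, x)]"] adj adj' r by simp
  qed
qed

text \<open>Every vertex other than \<open>v\<close> has \<open>v\<close> as its only neighbour; the
  indicators of \<open>v\<close> and of the other vertices form a wedge realising this star. Hence
  rank 4 forces an edge that avoids \<open>v\<close>.\<close>

lemma isolated_del_vert_imp_min_skew_rank_le_2:
  fixes G :: "('v, 'e) pre_digraph"
  assumes G: "graph G" and vs: "distinct vs" "set vs = verts G"
    and no_isolated: "\<not> (\<exists>u. isolated_vertex G u)"
    and isolated: "\<And>u. u \<in> verts (pre_digraph.del_vert G v) \<Longrightarrow> isolated_vertex (pre_digraph.del_vert G v) u"
  shows "min_skew_rank TYPE('a::field) vs G \<le> 2"
proof -
  interpret graph G by (rule G)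
  have star: "x \<rightarrow>\<^bsub>G\<^esub> w \<longleftrightarrow> w = v" if "x \<in> verts G" "x \<noteq> v" for x w
    using del_vert_isolatedD[OF no_isolated isolated] that by (simp add: pre_digraph.del_vert_simps)
  show ?thesis
  proof (rule min_skew_rank_wedge_le[OF vs,
        where f = "\<lambda>x. if x = v then 1 else (0 :: 'a)" and g = "\<lambda>x. if x = v then 0 else (1 :: 'a)"])
    fix x y assume "x \<in> verts G" "y \<in> verts G" "x \<noteq> y"
    moreover have "x \<rightarrow>\<^bsub>G\<^esub> y \<longleftrightarrow> y \<rightarrow>\<^bsub>G\<^esub> x" using graph_symmetric by blast
    ultimately show "(if x = v then 1 else 0) * (if y = v then 0 else 1)
        - (if x = v then 0 else 1) * (if y = v then 1 else 0) \<noteq> (0 :: 'a) \<longleftrightarrow> x \<rightarrow>\<^bsub>G\<^esub> y"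
      using star[of x y] star[of y x] by auto
  qed
qed

text \<open>Alternative (i), worded as in the theorem so that unfolding recovers the
  statement.\<close>

definition vertex_gluing :: "('v, 'e) pre_digraph \<Rightarrow> 'v \<Rightarrow> bool" where
  "vertex_gluing G v \<longleftrightarrow> (\<exists>G\<^sub>1 G\<^sub>2. compatible G\<^sub>1 G\<^sub>2 \<and> G = Digraph_Component.union G\<^sub>1 G\<^sub>2 \<and>
        verts G\<^sub>1 \<inter> verts G\<^sub>2 = {v} \<and>
        complete_multipartite G\<^sub>1 \<and> complete_multipartite G\<^sub>2 \<and>
        nonempty_graph (pre_digraph.del_vert G\<^sub>1 v) \<and>
        nonempty_graph (pre_digraph.del_vert G\<^sub>2 v))"

text \<open>Alternative (ii). If \<open>G\<close> has no isolated vertices, then the vertices other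
  than \<open>v\<close> outside \<open>C\<close> are pendant at \<open>v\<close>, whence the
  name.\<close>

definition pendant_extension :: "('v, 'e) pre_digraph \<Rightarrow> 'v \<Rightarrow> bool" where
  "pendant_extension G v \<longleftrightarrow> (\<exists>C \<in> pre_digraph.sccs (pre_digraph.del_vert G v).
        complete_multipartite C \<and> nonempty_graph C \<and>
        (\<forall>u \<in> verts (pre_digraph.del_vert G v) - verts C.
           isolated_vertex (pre_digraph.del_vert G v) u))"

subsection \<open>Cut vertices and rank four\<close>

text \<open>The rank enters only through the length of triangular patterns. If the component of
  \<open>a\<close> carries all edges of \<open>G - v\<close>, alternative (ii) results; otherwise
  there is a second edge \<open>p q\<close>, and the two components, each with \<open>v\<close>
  added, give (i).\<close>

lemma structure_of_triangular_bound:
  assumes G: "graph G" and no_isolated: "\<not> (\<exists>u. isolated_vertex G u)" and cut: "cut_vertex G v"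
    and bound: "\<And>ps. sorted_wrt (\<lambda>p q. \<not> fst p \<rightarrow>\<^bsub>G\<^esub> snd q) ps \<Longrightarrow>
      \<forall>p \<in> set ps. fst p \<rightarrow>\<^bsub>G\<^esub> snd p \<Longrightarrow> length ps \<le> 4"
    and ab: "a \<rightarrow>\<^bsub>G\<^esub> b" "a \<noteq> v" "b \<noteq> v"
  shows "vertex_gluing G v \<or> pendant_extension G v"
proof -
  interpret graph G by (rule G)
  interpret H: graph "del_vert v" using G by (rule graph_del_vert)
  have v: "v \<in> verts G" using cut by (simp add: cut_vertex_def)
  have irrefl: "\<not> x \<rightarrow>\<^bsub>G\<^esub> x" for x using adj_not_same by blast
  have sub: "S \<subseteq> verts G - {v}" if "S \<in> H.sccs_verts" for S
    using H.sccs_verts_subsets[OF that] by (simp add: pre_digraph.del_vert_simps)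
  have closed: "y \<in> S" if "S \<in> H.sccs_verts" "x \<in> S" "x \<rightarrow>\<^bsub>G\<^esub> y" "y \<noteq> v" for S x y
    using H.sccs_verts_closed[OF that(1,2), of y] that sub[OF that(1)] by (auto simp: dominates_del_vert)
  have scc: "H.scc_of x \<in> H.sccs_verts" "x \<in> H.scc_of x" if "x \<in> verts G" "x \<noteq> v" for x
    using that by (auto intro!: H.scc_of_in_sccs_verts H.in_scc_of_self simp: pre_digraph.del_vert_simps)
  define S where "S = H.scc_of a"
  have S: "S \<in> H.sccs_verts" "a \<in> S"
    unfolding S_def using scc[of a] ab adj_in_verts by auto
  then have bS: "b \<in> S" using closed ab by blast
  show ?thesis
  proof (cases "\<forall>u \<in> verts (del_vert v) - S. isolated_vertex (del_vert v) u")
    case True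
    obtain r where "r \<in> verts G" "r \<noteq> v" "r \<notin> S"
      using cut_vertex_outside_component[OF G cut S(1)] by blast
    with True have "isolated_vertex (del_vert v) r" by (simp add: pre_digraph.del_vert_simps)
    note r = del_vert_isolatedD[OF no_isolated this]
    \<comment> \<open>Since \<open>v\<close> is not in \<open>S\<close>, both restrictions are the
      same digraph, which is thereby itself a member of \<open>sccs\<close>.\<close>
    have eq: "del_vert v \<restriction> S = G \<restriction> S"
      using sub[OF S(1)] by (auto simp: induce_subgraph_def pre_digraph.del_vert_simps)
    have "complete_multipartite (G \<restriction> S)"
      by (rule pendant_component_multipartite[OF G S(1) bound S(2) ab(1,3) r])
    moreover have "G \<restriction> S \<in> H.sccs"
      using S(1) by (simp add: H.in_sccs_verts_conv eq)
    moreover have "nonempty_graph (G \<restriction> S)"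
      using ab S bS by (auto simp: nonempty_graph_iff dominates_induce_subgraph)
    ultimately show ?thesis
      using True unfolding pendant_extension_def by (metis induce_subgraph_verts)
  next
    case False
    then obtain p q where p: "p \<in> verts G" "p \<noteq> v" "p \<notin> S" and "p \<rightarrow>\<^bsub>del_vert v\<^esub> q"
      by (auto simp: isolated_vertex_def pre_digraph.del_vert_simps)
    then have pq: "p \<rightarrow>\<^bsub>G\<^esub> q" "q \<noteq> v" by (auto simp: dominates_del_vert)
    define T where "T = H.scc_of p"
    have T: "T \<in> H.sccs_verts" "p \<in> T" unfolding T_def using scc[of p] p by auto
    then have qT: "q \<in> T" using closed pq by blast
    have disj: "S \<inter> T = {}" using H.sccs_verts_disjoint[OF S(1) T(1)] T(2) p(3) by blast
    have qp: "q \<rightarrow>\<^bsub>G\<^esub> p" "b \<rightarrow>\<^bsub>G\<^esub> a" using pq ab graph_symmetric by blast+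
    have nadj: "\<not> x \<rightarrow>\<^bsub>G\<^esub> y" if "x \<notin> X" "x \<noteq> v" "y \<in> X" "X \<in> H.sccs_verts" for x y X
      using closed[OF that(4,3), of x] that graph_symmetric by blast
    \<comment> \<open>A vertex \<open>r\<close> of a third component has a neighbour
      \<open>s\<close>, possibly \<open>v\<close>. Its row vanishes at \<open>a\<close>,
      \<open>b\<close>, \<open>p\<close>, \<open>q\<close>, so \<open>(r, s)\<close> in front of the
      two edges gives length 5.\<close>
    have cover: "r \<in> S \<union> T" if r: "r \<in> verts G" "r \<noteq> v" for r
    proof (rule ccontr)
      assume notin: "r \<notin> S \<union> T"
      obtain s where s: "r \<rightarrow>\<^bsub>G\<^esub> s" using no_isolated r by (auto simp: isolated_vertex_def)
      have "\<not> r \<rightarrow>\<^bsub>G\<^esub> x" if "x \<in> {a, b, p, q}" for x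
        using nadj[of r S x] nadj[of r T x] notin r that S T bS qT by blast
      moreover have "\<not> x \<rightarrow>\<^bsub>G\<^esub> y" if "x \<in> {a, b}" "y \<in> {p, q}" for x y
        using nadj[of x T y] that S T bS qT disj ab by blast
      ultimately show False
        using bound[of "[(r, s), (a, b), (b, a), (p, q), (q, p)]"] s ab pq qp irrefl by simp
    qed
    have sccs: "H.sccs_verts = {S, T}"
    proof (intro equalityI subsetI)
      fix X assume X: "X \<in> H.sccs_verts"
      then obtain x where x: "x \<in> X" by (auto simp: H.in_sccs_verts_conv_reachable)
      then have "x \<in> S \<union> T" using sub[OF X] cover by blast
      then show "X \<in> {S, T}"
        using H.sccs_verts_disjoint[OF X S(1)] H.sccs_verts_disjoint[OF X T(1)] x by blast
    qed (use S T in auto)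
    obtain s where s: "s \<in> S" "v \<rightarrow>\<^bsub>G\<^esub> s"
      using cut_vertex_adjacent_component[OF G cut sccs] by blast
    have sccs': "H.sccs_verts = {T, S}" using sccs by (simp add: insert_commute)
    obtain t where t: "t \<in> T" "v \<rightarrow>\<^bsub>G\<^esub> t"
      using cut_vertex_adjacent_component[OF G cut sccs'] by blast
    let ?G1 = "G \<restriction> insert v S" and ?G2 = "G \<restriction> insert v T"
    have "complete_multipartite ?G1"
      using disj qT p pq
      by (intro block_multipartite[where p = p and q = q, OF G S(1) bound S(2) ab(1,3) v s]) auto
    moreover have "complete_multipartite ?G2"
      using disj S(2) bS ab
      by (intro block_multipartite[where p = a and q = b, OF G T(1) bound T(2) pq v t]) auto
    moreover have "compatible ?G1 ?G2" by (simp add: compatible_def)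
    moreover have "verts ?G1 \<inter> verts ?G2 = {v}" using disj by auto
    moreover have "nonempty_graph (pre_digraph.del_vert ?G1 v)" "nonempty_graph (pre_digraph.del_vert ?G2 v)"
      using ab S bS pq p T qT
      by (auto simp: nonempty_graph_iff dominates_del_vert dominates_induce_subgraph)
    moreover have "G = Digraph_Component.union ?G1 ?G2"
    proof (rule pre_digraph.equality)
      show "verts G = verts (Digraph_Component.union ?G1 ?G2)"
        using v sub[OF S(1)] sub[OF T(1)] cover by auto
      \<comment> \<open>An edge at \<open>v\<close> lies in the block of its other end; any other
        edge stays in the component of its tail.\<close>
      have "tail G e \<in> insert v S \<and> head G e \<in> insert v S \<or> tail G e \<in> insert v T \<and> head G e \<in> insert v T"
        if "e \<in> arcs G" for e
      proof -
        have adj: "tail G e \<rightarrow>\<^bsub>G\<^esub> head G e" using that by (auto simp: arcs_ends_conv)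
        show ?thesis
        proof (cases "tail G e = v \<or> head G e = v")
          case True
          then show ?thesis using cover[of "tail G e"] cover[of "head G e"] that by auto
        next
          case False
          then have "tail G e \<in> S \<union> T" using cover that by simp
          then show ?thesis using closed[OF S(1) _ adj] closed[OF T(1) _ adj] False by blast
        qed
      qed
      then show "arcs G = arcs (Digraph_Component.union ?G1 ?G2)"
        unfolding arcs_union induce_subgraph_arcs by blast
    qed simp_all
    ultimately show ?thesis unfolding vertex_gluing_def by blast
  qed
qed

section \<open>Upper and lower bounds in the two alternatives\<close>

text \<open>Each block contributes the wedge of \<open>1\<close> and its part labels, both extended
  by zero.\<close>

lemma vertex_gluing_min_skew_rank_le:
  fixes G :: "('v, 'e) pre_digraph"
  assumes inf: "infinite (UNIV :: 'a::field set)" and vs: "distinct vs" "set vs = verts G"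
    and glue: "vertex_gluing G v"
  shows "min_skew_rank TYPE('a) vs G \<le> 4"
proof -
  from glue obtain G1 G2 where G12: "compatible G1 G2" "G = Digraph_Component.union G1 G2"
    "verts G1 \<inter> verts G2 = {v}" "complete_multipartite G1" "complete_multipartite G2"
    unfolding vertex_gluing_def by blast
  interpret G1: graph G1 using G12(4) by (simp add: complete_multipartite_def)
  interpret G2: graph G2 using G12(5) by (simp add: complete_multipartite_def)
  obtain t1 :: "'v \<Rightarrow> 'a" where t1: "\<And>u w. u \<in> verts G1 \<Longrightarrow> w \<in> verts G1 \<Longrightarrow> t1 u \<noteq> t1 w \<longleftrightarrow> u \<rightarrow>\<^bsub>G1\<^esub> w"
    using complete_multipartite_labelling[OF inf G12(4)] by blast
  obtain t2 :: "'v \<Rightarrow> 'a" where t2: "\<And>u w. u \<in> verts G2 \<Longrightarrow> w \<in> verts G2 \<Longrightarrow> t2 u \<noteq> t2 w \<longleftrightarrow> u \<rightarrow>\<^bsub>G2\<^esub> w"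
    using complete_multipartite_labelling[OF inf G12(5)] by blast
  let ?f = "\<lambda>x. if x \<in> verts G1 then 1 else (0 :: 'a)" and ?g = "\<lambda>x. if x \<in> verts G1 then t1 x else 0"
  let ?h = "\<lambda>x. if x \<in> verts G2 then 1 else (0 :: 'a)" and ?k = "\<lambda>x. if x \<in> verts G2 then t2 x else 0"
  show ?thesis
  proof (rule min_skew_rank_two_wedges_le[OF vs, where f = ?f and g = ?g and h = ?h and k = ?k])
    fix x y assume xy: "x \<in> verts G" "y \<in> verts G" "x \<noteq> y"
    have 1: "?f x * ?g y - ?g x * ?f y \<noteq> 0 \<longleftrightarrow> x \<rightarrow>\<^bsub>G1\<^esub> y"
      using t1[of x y] G1.adj_in_verts[of x y] by auto
    have 2: "?h x * ?k y - ?k x * ?h y \<noteq> 0 \<longleftrightarrow> x \<rightarrow>\<^bsub>G2\<^esub> y"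
      using t2[of x y] G2.adj_in_verts[of x y] by auto
    \<comment> \<open>The blocks share only \<open>v\<close>, so two distinct vertices never lie in
      both; one wedge vanishes at each pair and nothing cancels.\<close>
    have "\<not> (x \<in> verts G1 \<inter> verts G2 \<and> y \<in> verts G1 \<inter> verts G2)"
      using xy(3) unfolding G12(3) by auto
    then have "?f x * ?g y - ?g x * ?f y = 0 \<or> ?h x * ?k y - ?k x * ?h y = 0" by auto
    then show "(?f x * ?g y - ?g x * ?f y) + (?h x * ?k y - ?k x * ?h y) \<noteq> 0 \<longleftrightarrow> x \<rightarrow>\<^bsub>G\<^esub> y"
      using 1 2 G12(2) dominates_union[OF G12(1), of x y] by (metis add.left_neutral add.right_neutral)
  qed
qed

text \<open>An edge avoiding \<open>v\<close> from each block, taken in both directions, gives four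
  pairs; as the blocks meet only in \<open>v\<close>, no arc joins the two edges.\<close>

lemma vertex_gluing_pattern:
  assumes "vertex_gluing G v"
  obtains ps where "length ps = 4" "sorted_wrt (\<lambda>p q. \<not> fst p \<rightarrow>\<^bsub>G\<^esub> snd q) ps"
    "\<forall>p \<in> set ps. fst p \<rightarrow>\<^bsub>G\<^esub> snd p"
proof -
  from assms obtain G1 G2 where G12: "compatible G1 G2" "G = Digraph_Component.union G1 G2"
    "verts G1 \<inter> verts G2 = {v}" "complete_multipartite G1" "complete_multipartite G2"
    and ne: "nonempty_graph (pre_digraph.del_vert G1 v)" "nonempty_graph (pre_digraph.del_vert G2 v)"
    unfolding vertex_gluing_def by blast
  interpret G1: graph G1 using G12(4) by (simp add: complete_multipartite_def)
  interpret G2: graph G2 using G12(5) by (simp add: complete_multipartite_def)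
  note adj = dominates_union[OF G12(1), folded G12(2)]
  from ne obtain a b p q where ab: "a \<rightarrow>\<^bsub>G1\<^esub> b" "a \<noteq> v" "b \<noteq> v" and pq: "p \<rightarrow>\<^bsub>G2\<^esub> q" "p \<noteq> v" "q \<noteq> v"
    by (auto simp: nonempty_graph_iff dominates_del_vert)
  have V1: "a \<in> verts G1" "b \<in> verts G1" "p \<notin> verts G1" "q \<notin> verts G1"
    and V2: "p \<in> verts G2" "q \<in> verts G2" "a \<notin> verts G2" "b \<notin> verts G2"
    using G1.adj_in_verts[OF ab(1)] G2.adj_in_verts[OF pq(1)] ab pq G12(3) by blast+
  have "\<not> x \<rightarrow>\<^bsub>G\<^esub> y" if "x \<in> {a, b}" "y \<in> {p, q}" for x y
    unfolding adj using that V1 V2 G1.adj_in_verts G2.adj_in_verts by blast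
  moreover have "\<not> x \<rightarrow>\<^bsub>G\<^esub> x" for x
    unfolding adj using G1.adj_not_same G2.adj_not_same by blast
  moreover have "a \<rightarrow>\<^bsub>G\<^esub> b" "b \<rightarrow>\<^bsub>G\<^esub> a" "p \<rightarrow>\<^bsub>G\<^esub> q" "q \<rightarrow>\<^bsub>G\<^esub> p"
    unfolding adj using ab pq G1.graph_symmetric G2.graph_symmetric by blast+
  ultimately show ?thesis
    by (intro that[of "[(a, b), (b, a), (p, q), (q, p)]"]) auto
qed

text \<open>One wedge realises \<open>C\<close>; the other, from the indicators of \<open>v\<close>
  and of its neighbourhood, produces the edges at \<open>v\<close>. The first vanishes at
  \<open>v\<close> and the second away from it, so they do not interfere.\<close>

lemma pendant_extension_min_skew_rank_le:
  fixes G :: "('v, 'e) pre_digraph"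
  assumes inf: "infinite (UNIV :: 'a::field set)" and G: "graph G"
    and vs: "distinct vs" "set vs = verts G" and ext: "pendant_extension G v"
  shows "min_skew_rank TYPE('a) vs G \<le> 4"
proof -
  interpret graph G by (rule G)
  interpret H: graph "del_vert v" using G by (rule graph_del_vert)
  from ext obtain C where C: "C \<in> H.sccs" "complete_multipartite C"
    and isolated: "\<And>u. u \<in> verts (del_vert v) - verts C \<Longrightarrow> isolated_vertex (del_vert v) u"
    unfolding pendant_extension_def by blast
  have ind: "induced_subgraph C (del_vert v)" using C(1) by (rule H.in_sccs_imp_induced)
  have C_adj: "x \<rightarrow>\<^bsub>C\<^esub> y \<longleftrightarrow> x \<rightarrow>\<^bsub>G\<^esub> y" if "x \<in> verts C" "y \<in> verts C" "x \<noteq> v" "y \<noteq> v" for x y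
    using that by (simp add: dominates_induced[OF ind] dominates_del_vert)
  have "verts C \<subseteq> verts (del_vert v)" by (rule subgraph_imp_subverts[OF induced_imp_subgraph[OF ind]])
  then have v_C: "v \<notin> verts C" by (auto simp: pre_digraph.del_vert_simps)
  have sym: "x \<rightarrow>\<^bsub>G\<^esub> y \<longleftrightarrow> y \<rightarrow>\<^bsub>G\<^esub> x" for x y using graph_symmetric by blast
  have outside: "\<not> x \<rightarrow>\<^bsub>G\<^esub> y" if "x \<in> verts G" "x \<notin> verts C" "x \<noteq> v" "y \<noteq> v" for x y
    using isolated[of x] that
    by (auto simp: pre_digraph.del_vert_simps isolated_vertex_def dominates_del_vert)
  obtain t :: "'v \<Rightarrow> 'a" where t: "\<And>u w. u \<in> verts C \<Longrightarrow> w \<in> verts C \<Longrightarrow> t u \<noteq> t w \<longleftrightarrow> u \<rightarrow>\<^bsub>C\<^esub> w"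
    using complete_multipartite_labelling[OF inf C(2)] by blast
  let ?f = "\<lambda>x. if x \<in> verts C then 1 else (0 :: 'a)" and ?g = "\<lambda>x. if x \<in> verts C then t x else 0"
  let ?h = "\<lambda>x. if x = v then 1 else (0 :: 'a)" and ?k = "\<lambda>x. if v \<rightarrow>\<^bsub>G\<^esub> x then 1 else (0 :: 'a)"
  show ?thesis
  proof (rule min_skew_rank_two_wedges_le[OF vs, where f = ?f and g = ?g and h = ?h and k = ?k])
    fix x y assume xy: "x \<in> verts G" "y \<in> verts G" "x \<noteq> y"
    consider "x = v" | "y = v" | "x \<noteq> v" "y \<noteq> v" by blast
    then show "(?f x * ?g y - ?g x * ?f y) + (?h x * ?k y - ?k x * ?h y) \<noteq> 0 \<longleftrightarrow> x \<rightarrow>\<^bsub>G\<^esub> y"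
    proof cases
      case 3
      then show ?thesis
        using t[of x y] C_adj[of x y] outside[of x y] outside[of y x] sym[of x y] xy by auto
    qed (use v_C xy sym[of x y] in auto)
  qed
qed

text \<open>The cut vertex yields an \<open>r\<close> outside \<open>C\<close>, pendant at
  \<open>v\<close>. Since \<open>v\<close> may be adjacent to \<open>a\<close> and \<open>b\<close>,
  its column has to come first, in \<open>(r, v)\<close>, and its row last, in
  \<open>(v, r)\<close>.\<close>

lemma pendant_extension_pattern:
  assumes G: "graph G" and no_isolated: "\<not> (\<exists>u. isolated_vertex G u)" and cut: "cut_vertex G v"
    and ext: "pendant_extension G v"
  obtains ps where "length ps = 4" "sorted_wrt (\<lambda>p q. \<not> fst p \<rightarrow>\<^bsub>G\<^esub> snd q) ps"
    "\<forall>p \<in> set ps. fst p \<rightarrow>\<^bsub>G\<^esub> snd p"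
proof -
  interpret graph G by (rule G)
  interpret H: graph "del_vert v" using G by (rule graph_del_vert)
  from ext obtain C where C: "C \<in> H.sccs" "nonempty_graph C"
    and isolated: "\<And>u. u \<in> verts (del_vert v) - verts C \<Longrightarrow> isolated_vertex (del_vert v) u"
    unfolding pendant_extension_def by blast
  have ind: "induced_subgraph C (del_vert v)" using C(1) by (rule H.in_sccs_imp_induced)
  from C(2) obtain a b where ab: "a \<rightarrow>\<^bsub>G\<^esub> b" "a \<noteq> v" "b \<noteq> v"
    by (auto simp: nonempty_graph_iff dominates_induced[OF ind] dominates_del_vert)
  have "verts C \<in> H.sccs_verts" using C(1) by (simp add: H.sccs_verts_conv)
  then obtain r where "r \<in> verts G" "r \<noteq> v" "r \<notin> verts C"
    using cut_vertex_outside_component[OF G cut] by blast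
  then have "isolated_vertex (del_vert v) r" using isolated by (simp add: pre_digraph.del_vert_simps)
  note r = del_vert_isolatedD[OF no_isolated this]
  then have "v \<rightarrow>\<^bsub>G\<^esub> r" "b \<rightarrow>\<^bsub>G\<^esub> a" "\<not> a \<rightarrow>\<^bsub>G\<^esub> r" "\<not> b \<rightarrow>\<^bsub>G\<^esub> r"
    using ab graph_symmetric by blast+
  moreover have "\<not> x \<rightarrow>\<^bsub>G\<^esub> x" for x using adj_not_same by blast
  ultimately show ?thesis using ab r by (intro that[of "[(r, v), (a, b), (b, a), (v, r)]"]) auto
qed

theorem theorem3p1:
  fixes G :: "('v, 'e) pre_digraph" and v :: 'v and vs :: "'v list"
  assumes "infinite (UNIV :: 'a::field set)" and "CHAR('a) \<noteq> 2"
    and "graph G" and "distinct vs" and "set vs = verts G"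
    and "\<not> (\<exists>u. isolated_vertex G u)"
    and "cut_vertex G v"
  shows "min_skew_rank TYPE('a) vs G = 4 \<longleftrightarrow>
    (\<exists>G\<^sub>1 G\<^sub>2. compatible G\<^sub>1 G\<^sub>2 \<and> G = Digraph_Component.union G\<^sub>1 G\<^sub>2 \<and>
        verts G\<^sub>1 \<inter> verts G\<^sub>2 = {v} \<and>
        complete_multipartite G\<^sub>1 \<and> complete_multipartite G\<^sub>2 \<and>
        nonempty_graph (pre_digraph.del_vert G\<^sub>1 v) \<and>
        nonempty_graph (pre_digraph.del_vert G\<^sub>2 v)) \<or>
    (\<exists>C \<in> pre_digraph.sccs (pre_digraph.del_vert G v).
        complete_multipartite C \<and> nonempty_graph C \<and>
        (\<forall>u \<in> verts (pre_digraph.del_vert G v) - verts C.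
           isolated_vertex (pre_digraph.del_vert G v) u))"
proof -
  \<comment> \<open>The rank of an optimal matrix is the minimum itself, so \<open>lower\<close>
    bounds the minimum by the length of any triangular pattern.\<close>
  obtain A :: "'a mat" where A: "A \<in> skew_matrices vs G"
    "vec_space.rank (length vs) A = min_skew_rank TYPE('a) vs G"
    using min_skew_rank_attained[OF assms(3)] by blast
  note lower = skew_matrices_rank_ge[OF A(1) assms(2,3,5), unfolded A(2)]
  have "min_skew_rank TYPE('a) vs G = 4 \<longleftrightarrow> vertex_gluing G v \<or> pendant_extension G v"
  proof
    assume rank: "min_skew_rank TYPE('a) vs G = 4"
    \<comment> \<open>A minimum above 2 excludes the star, which leaves an edge avoiding
      \<open>v\<close>.\<close>
    then have "\<not> min_skew_rank TYPE('a) vs G \<le> 2" by simp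
    then obtain a where "a \<in> verts (pre_digraph.del_vert G v)" "\<not> isolated_vertex (pre_digraph.del_vert G v) a"
      using isolated_del_vert_imp_min_skew_rank_le_2[OF assms(3-6), of v] by blast
    then obtain b where "a \<rightarrow>\<^bsub>G\<^esub> b" "a \<noteq> v" "b \<noteq> v"
      by (auto simp: isolated_vertex_def dominates_del_vert)
    then show "vertex_gluing G v \<or> pendant_extension G v"
      using structure_of_triangular_bound[OF assms(3,6,7)] lower rank by metis
  next
    assume cases: "vertex_gluing G v \<or> pendant_extension G v"
    then have "min_skew_rank TYPE('a) vs G \<le> 4"
      using vertex_gluing_min_skew_rank_le[OF assms(1,4,5)]
        pendant_extension_min_skew_rank_le[OF assms(1,3-5)] by blast
    moreover from cases have "4 \<le> min_skew_rank TYPE('a) vs G"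
    proof
      assume "vertex_gluing G v"
      then show ?thesis by (rule vertex_gluing_pattern) (metis lower)
    next
      assume "pendant_extension G v"
      then show ?thesis by (rule pendant_extension_pattern[OF assms(3,6,7)]) (metis lower)
    qed
    ultimately show "min_skew_rank TYPE('a) vs G = 4" by simp
  qed
  then show ?thesis unfolding vertex_gluing_def pendant_extension_def .
qed

end
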